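(* Let $G$ be a locally compact abelian group, $(X,\mu_{\rho\backslash X}^\#)$ a Weil $G$-space with action $\rho$, $F$ a measurable fundamental domain of $\rho$, and $f\in L^1(X,\mu_{\rho\backslash X}^\#)$. Then the extended Zak transform satisfies $$\mathcal{Z}_\rho^Xf(\rho_g^{-1}(x_0),\chi)=\chi(g)\,\mathcal{Z}_\rho f(x_0,\chi),\qquad g\in G,\ x_0\in F,\ \chi\in\widehat{G}.$$ In particular, the Zak transform $\mathcal{Z}_\rho f$ vanishes on the set $\{(x_0,\chi)\in F\times\widehat{G}:\chi\notin(G_{x_0})_G^\bot\}$.
   Context: Actions. Let a locally compact Hausdorff (lcH) group $G$ act continuously on an lcH space $X$ via $\rho$; $\rho_g(x)=\rho(g,x)$, $(\rho_gf)(x)=f(\rho_g^{-1}(x))$ for functions, $\pi_\rho:X\to\rho\backslash X$ is the quotient map to the orbit space, $G_x$ the stabilizer of $x$. The action is strongly proper if all $G_x$ are compact, for every $x\in X$ and every neighborhood $U$ of $G_x$ there is a neighborhood $V$ of $x$ with $\{g:\rho_g(V)\cap V\ne\emptyset\}\subseteq U$, and $\rho\backslash X$ is paracompact. Weil $G$-space. Let $\mu_G$ be a left Haar measure and $\Delta_G$ the modular function ($\mathrm{d}\mu_G(gh)=\Delta_G(h)\mathrm{d}\mu_G(g)$). For $f\in C_c(X)$ let $A_\rho f(\pi_\rho(x))=\int_G f(\rho_g^{-1}(x))\,\mathrm{d}\mu_G(g)$. $(X,\mu_{\rho\backslash X}^\#)$ is a Weil $G$-space if $\rho$ is strongly proper,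 there is a $\rho$-quasi-invariant Radon measure $\mu_X$ on $X$ (there are continuous functions $\lambda_g$ with $\int_X\rho_gf\,\mathrm{d}\mu_X=\int_Xf\lambda_g\,\mathrm{d}\mu_X$ for all $f\in C_c(X)$), a strictly positive continuous function $q$ on $X$ with $q(\rho_g^{-1}(x))=\frac{\Delta_G(g)}{\lambda_{g^{-1}}(x)}q(x)$, and a Radon measure $\mu_{\rho\backslash X}$ on $\rho\backslash X$ such that $\int_Xf q\,\mathrm{d}\mu_X=\int_{\rho\backslash X}A_\rho f\,\mathrm{d}\mu_{\rho\backslash X}$ for all $f\in C_c(X)$, and $\mathrm{d}\mu_{\rho\backslash X}^\#=q\,\mathrm{d}\mu_X$. A measurable fundamental domain is a measurable set $F\subseteq X$ such that $\pi_\rho|_F:F\to\rho\backslash X$ is a bijection. $\widehat{G}$ is the dual group of $G$ (continuous characters into the unit circle). For a closed subgroup $H\le G$, $H_G^\bot=\{\chi\in\widehat{G}:\chi(h)=1\ \forall h\in H\}$. The Zak transform of $f\in L^1(X,\mu_{\rho\backslash X}^\#)$ is $\mathcal{Z}_\rho f(x_0,\chi)=\int_Gf(\rho_g^{-1}(x_0))\overline{\chi(g)}\,\mathrm{d}\mu_G(g)$, $x_0\in F$, $\chi\in\widehat{G}$; the extended Zak transform $\mathcal{Z}_\rho^Xf$ on $X\times\widehat{G}$ is given by the same formula with $x_0\in X$. These are defined along all orbits on which $g\mapsto f(\rho_g^{-1}(x_0))$ is in $L^1(G)$, which are $\mu_{\rho\backslash X}$-almost all orbits; the statement refers to such $x_0$.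 *)

theory Defs
  imports "HOL-Analysis.Analysis"
begin

text \<open>
  Groups are written additively, so that the library class \<open>topological_group_add\<close> (which does not
  presuppose commutativity) can be used: \<open>g + h\<close> is the product \<open>gh\<close>, \<open>- g\<close> the inverse and
  \<open>0\<close> the neutral element.
\<close>

section \<open>Topological prerequisites\<close>

text \<open>Paracompactness includes the Hausdorff property, as in Bourbaki and Engelking.\<close>

definition paracompact_space :: "'a topology \<Rightarrow> bool" where
  "paracompact_space T \<longleftrightarrow> Hausdorff_space T \<and>
     (\<forall>\<U>. (\<forall>U\<in>\<U>. openin T U) \<and> \<Union>\<U> = topspace T \<longrightarrow>
        (\<exists>\<V>. (\<forall>V\<in>\<V>. openin T V) \<and> \<Union>\<V> = topspace T \<and>
             (\<forall>V\<in>\<V>. \<exists>U\<in>\<U>. V \<subseteq> U) \<and> locally_finite_in T \<V>))"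

definition Cc :: "('a::topological_space \<Rightarrow> complex) set" where
  "Cc = {f. continuous_on UNIV f \<and> compact (closure {x. f x \<noteq> 0})}"

section \<open>Radon and Haar measures\<close>

text \<open>
  A Radon measure is a Borel measure that is finite on compact sets, outer regular on Borel sets
  and inner regular on open sets. An abstract topology is used because the orbit space below is
  not a type. For \<open>T = euclidean\<close> the \<open>\<sigma>\<close>-algebra is that of \<^const>\<open>borel\<close>.
\<close>

definition radon_measure :: "'a topology \<Rightarrow> 'a measure \<Rightarrow> bool" where
  "radon_measure T M \<longleftrightarrow>
     sets M = sets (sigma (topspace T) {U. openin T U}) \<and>
     (\<forall>K. compactin T K \<longrightarrow> emeasure M K < \<infinity>) \<and>
     (\<forall>A\<in>sets M. emeasure M A = (INF U\<in>{U. openin T U \<and> A \<subseteq> U}. emeasure M U)) \<and>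
     (\<forall>U. openin T U \<longrightarrow> emeasure M U = (SUP K\<in>{K. compactin T K \<and> K \<subseteq> U}. emeasure M K))"

lemma radon_measure_euclidean_sets:
  assumes "radon_measure (euclidean :: 'a::topological_space topology) M"
  shows "sets M = sets borel"
  using assms by (simp add: radon_measure_def borel_def)

definition left_haar_measure :: "'g::topological_group_add measure \<Rightarrow> bool" where
  "left_haar_measure M \<longleftrightarrow>
     radon_measure euclidean M \<and> emeasure M UNIV \<noteq> 0 \<and>
     (\<forall>g. \<forall>E\<in>sets M. emeasure M ((\<lambda>h. g + h) ` E) = emeasure M E)"

text \<open>
  The convention is \<open>d\<mu>(gh) = \<Delta>(h) d\<mu>(g)\<close>, that is, \<open>\<mu>(Eh) = \<Delta>(h) \<mu>(E)\<close>. For a left Haar measure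
  the number \<open>\<Delta>(h)\<close> exists and is unique.
\<close>

definition modular_function :: "'g::topological_group_add measure \<Rightarrow> 'g \<Rightarrow> real" where
  "modular_function M h =
     (THE c. 0 < c \<and> (\<forall>E\<in>sets M. emeasure M ((\<lambda>g. g + h) ` E) = ennreal c * emeasure M E))"

section \<open>Actions\<close>

text \<open>Throughout, \<open>\<rho>\<^sub>g\<inverse>\<close> is written \<open>\<rho> (- g)\<close>; see \<open>inv_action\<close> below.\<close>

definition continuous_action ::
    "('g::topological_group_add \<Rightarrow> 'x::topological_space \<Rightarrow> 'x) \<Rightarrow> bool" where
  "continuous_action \<rho> \<longleftrightarrow>
     (\<forall>x. \<rho> 0 x = x) \<and> (\<forall>g h x. \<rho> (g + h) x = \<rho> g (\<rho> h x)) \<and>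
     continuous_on UNIV (\<lambda>(g, x). \<rho> g x)"

lemma inv_action:
  assumes "continuous_action \<rho>"
  shows "inv (\<rho> g) = \<rho> (- g)"
proof (rule inv_equality)
  fix x
  have "\<rho> (- g) (\<rho> g x) = \<rho> (- g + g) x" "\<rho> g (\<rho> (- g) x) = \<rho> (g + - g) x"
    using assms unfolding continuous_action_def by presburger+
  then show "\<rho> (- g) (\<rho> g x) = x" "\<rho> g (\<rho> (- g) x) = x"
    using assms by (simp_all add: continuous_action_def)
qed

definition stabilizer :: "('g \<Rightarrow> 'x \<Rightarrow> 'x) \<Rightarrow> 'x \<Rightarrow> 'g set" where
  "stabilizer \<rho> x = {g. \<rho> g x = x}"

definition orbit :: "('g \<Rightarrow> 'x \<Rightarrow> 'x) \<Rightarrow> 'x \<Rightarrow> 'x set" where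
  "orbit \<rho> x = range (\<lambda>g. \<rho> g x)"

definition orbit_space :: "('g \<Rightarrow> 'x::topological_space \<Rightarrow> 'x) \<Rightarrow> 'x set topology" where
  "orbit_space \<rho> = topology (\<lambda>\<U>. \<U> \<subseteq> range (orbit \<rho>) \<and> open (orbit \<rho> -` \<U>))"

lemma openin_orbit_space:
  "openin (orbit_space \<rho>) \<U> \<longleftrightarrow> \<U> \<subseteq> range (orbit \<rho>) \<and> open (orbit \<rho> -` \<U>)"
proof -
  have "istopology (\<lambda>\<U>. \<U> \<subseteq> range (orbit \<rho>) \<and> open (orbit \<rho> -` \<U>))"
    unfolding istopology_def by (auto simp: vimage_Union intro: open_UN)
  then show ?thesis
    by (simp add: orbit_space_def topology_inverse')
qed

lemma topspace_orbit_space: "topspace (orbit_space \<rho>) = range (orbit \<rho>)"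
proof -
  have "openin (orbit_space \<rho>) (range (orbit \<rho>))"
    by (auto simp: openin_orbit_space vimage_def)
  moreover have "topspace (orbit_space \<rho>) \<subseteq> range (orbit \<rho>)"
    using openin_topspace openin_orbit_space by blast
  ultimately show ?thesis
    using openin_subset by blast
qed

lemma quotient_map_orbit: "quotient_map euclidean (orbit_space \<rho>) (orbit \<rho>)"
  by (auto simp: quotient_map_def topspace_orbit_space openin_orbit_space vimage_def)

text \<open>Neighbourhoods are not required to be open, hence the interiors.\<close>

definition strongly_proper ::
    "('g::topological_group_add \<Rightarrow> 'x::topological_space \<Rightarrow> 'x) \<Rightarrow> bool" where
  "strongly_proper \<rho> \<longleftrightarrow>
     (\<forall>x. compact (stabilizer \<rho> x)) \<and>
     (\<forall>x U. stabilizer \<rho> x \<subseteq> interior U \<longrightarrow>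
        (\<exists>V. x \<in> interior V \<and> {g. \<rho> g ` V \<inter> V \<noteq> {}} \<subseteq> U)) \<and>
     paracompact_space (orbit_space \<rho>)"

section \<open>Weil spaces\<close>

text \<open>
  \<open>A\<^sub>\<rho> f\<close> as a function on orbits. The choice of the base point is immaterial, see
  \<open>orbit_average_orbit\<close>.
\<close>

definition orbit_average ::
    "'g::topological_group_add measure \<Rightarrow> ('g \<Rightarrow> 'x \<Rightarrow> 'x) \<Rightarrow> ('x \<Rightarrow> complex) \<Rightarrow> 'x set \<Rightarrow> complex" where
  "orbit_average \<mu>G \<rho> f \<O> = (LINT g|\<mu>G. f (\<rho> (- g) (SOME x. x \<in> \<O>)))"

lemma orbit_average_orbit:
  fixes \<rho> :: "'g::topological_group_add \<Rightarrow> 'x::topological_space \<Rightarrow> 'x"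
  assumes haar: "left_haar_measure \<mu>G" and act: "continuous_action \<rho>" and f: "f \<in> Cc"
  shows "orbit_average \<mu>G \<rho> f (orbit \<rho> x) = (LINT g|\<mu>G. f (\<rho> (- g) x))"
proof -
  have sets: "sets \<mu>G = sets borel"
    using haar by (simp add: left_haar_measure_def radon_measure_euclidean_sets)
  then have space: "space \<mu>G = UNIV"
    using sets_eq_imp_space_eq by force
  have comp: "\<rho> (a + b) y = \<rho> a (\<rho> b y)" for a b y
    using act by (simp add: continuous_action_def)
  have "x \<in> orbit \<rho> x"
    using act by (auto simp: orbit_def continuous_action_def intro!: range_eqI[of _ _ 0])
  then have "(SOME y. y \<in> orbit \<rho> x) \<in> orbit \<rho> x"
    by (rule someI)
  then obtain h where h: "(SOME y. y \<in> orbit \<rho> x) = \<rho> h x"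
    by (auto simp: orbit_def)
  have add_cont: "continuous_on UNIV (\<lambda>g. k + g)" for k :: 'g
    unfolding continuous_on_def by (auto intro!: tendsto_add)
  have meas: "(\<lambda>g. k + g) \<in> measurable \<mu>G \<mu>G" for k
    using borel_measurable_continuous_onI[OF add_cont[of k]] sets
    by (simp cong: measurable_cong_sets)
  have distr: "distr \<mu>G \<mu>G (\<lambda>g. - h + g) = \<mu>G"
  proof (rule measure_eqI)
    fix A assume "A \<in> sets (distr \<mu>G \<mu>G (\<lambda>g. - h + g))"
    then have A: "A \<in> sets \<mu>G" by simp
    have "(\<lambda>g. - h + g) -` A = (\<lambda>g. h + g) ` A"
    proof (intro equalityI subsetI)
      fix g assume "g \<in> (\<lambda>g. - h + g) -` A"
      then show "g \<in> (\<lambda>g. h + g) ` A"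
        by (intro image_eqI[of _ _ "- h + g"]) (simp_all flip: add.assoc)
    qed (auto simp flip: add.assoc)
    then show "emeasure (distr \<mu>G \<mu>G (\<lambda>g. - h + g)) A = emeasure \<mu>G A"
      using haar A by (simp add: emeasure_distr meas space left_haar_measure_def)
  qed simp
  have "continuous_on UNIV (\<lambda>g :: 'g. (- g, x))"
    unfolding continuous_on_def
    by (intro ballI tendsto_Pair tendsto_minus[OF tendsto_ident_at] tendsto_const)
  then have "continuous_on UNIV (\<lambda>g. f (\<rho> (- g) x))"
    using act f unfolding continuous_action_def Cc_def
    by (auto intro!: continuous_on_compose2[of UNIV f]
        intro: continuous_on_compose2[of UNIV "\<lambda>(g, x). \<rho> g x" UNIV "\<lambda>g. (- g, x)", simplified])
  then have fm: "(\<lambda>g. f (\<rho> (- g) x)) \<in> borel_measurable \<mu>G"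
    using borel_measurable_continuous_onI sets by (simp cong: measurable_cong_sets)
  have "orbit_average \<mu>G \<rho> f (orbit \<rho> x) = (LINT g|\<mu>G. f (\<rho> (- (- h + g)) x))"
    unfolding orbit_average_def h
    by (simp only: minus_add minus_minus comp)
  also have "\<dots> = (LINT g|distr \<mu>G \<mu>G (\<lambda>g. - h + g). f (\<rho> (- g) x))"
    by (rule integral_distr[symmetric, OF meas fm])
  finally show ?thesis
    by (simp only: distr)
qed

text \<open>
  \<open>weil_space \<mu>G \<rho> \<mu>s\<close> states that the space acted on, with the measure \<open>\<mu>s = \<mu>\<^sup>#\<close> (the density \<open>q\<close>
  times \<open>\<mu>X\<close>), is a Weil \<open>G\<close>-space; \<open>\<mu>Q\<close> is the measure on the orbit space. The functions \<open>l g\<close>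
  express the quasi-invariance of \<open>\<mu>X\<close>; they are positive since \<open>q\<close> is.
\<close>

definition weil_space ::
    "'g::topological_group_add measure \<Rightarrow> ('g \<Rightarrow> 'x::topological_space \<Rightarrow> 'x) \<Rightarrow> 'x measure \<Rightarrow> bool" where
  "weil_space \<mu>G \<rho> \<mu>s \<longleftrightarrow>
     strongly_proper \<rho> \<and>
     (\<exists>(\<mu>X :: 'x measure) (l :: 'g \<Rightarrow> 'x \<Rightarrow> real) (q :: 'x \<Rightarrow> real) (\<mu>Q :: 'x set measure).
        radon_measure euclidean \<mu>X \<and>
        (\<forall>g. continuous_on UNIV (l g)) \<and>
        (\<forall>g. \<forall>f\<in>Cc. (LINT x|\<mu>X. f (\<rho> (- g) x)) = (LINT x|\<mu>X. f x * of_real (l g x))) \<and>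
        continuous_on UNIV q \<and> (\<forall>x. 0 < q x) \<and>
        (\<forall>g x. q (\<rho> (- g) x) = modular_function \<mu>G g / l (- g) x * q x) \<and>
        radon_measure (orbit_space \<rho>) \<mu>Q \<and>
        (\<forall>f\<in>Cc. (LINT x|\<mu>X. f x * of_real (q x)) = (LINT \<O>|\<mu>Q. orbit_average \<mu>G \<rho> f \<O>)) \<and>
        \<mu>s = density \<mu>X (\<lambda>x. ennreal (q x)))"

definition fundamental_domain :: "('g \<Rightarrow> 'x::topological_space \<Rightarrow> 'x) \<Rightarrow> 'x set \<Rightarrow> bool" where
  "fundamental_domain \<rho> F \<longleftrightarrow>
     F \<in> sets borel \<and> bij_betw (orbit \<rho>) F (topspace (orbit_space \<rho>))"

section \<open>Characters and the Zak transform\<close>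

definition dual_group :: "('g::topological_ab_group_add \<Rightarrow> complex) set" where
  "dual_group = {\<xi>. continuous_on UNIV \<xi> \<and> (\<forall>g. norm (\<xi> g) = 1) \<and>
                    (\<forall>g h. \<xi> (g + h) = \<xi> g * \<xi> h)}"

definition annihilator :: "'g::topological_ab_group_add set \<Rightarrow> ('g \<Rightarrow> complex) set" where
  "annihilator H = {\<xi>\<in>dual_group. \<forall>h\<in>H. \<xi> h = 1}"

text \<open>
  The Zak transforms are partial functions, defined only along the orbits on which \<open>f\<close> is
  integrable with respect to the Haar measure. They are left unspecified elsewhere, so that the
  convention that the integral of a non-integrable function is \<open>0\<close> plays no role.
\<close>

definition zak_dom ::
    "'g::topological_ab_group_add measure \<Rightarrow> ('g \<Rightarrow> 'x \<Rightarrow> 'x) \<Rightarrow> ('x \<Rightarrow> complex) \<Rightarrow> 'x set" where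
  "zak_dom \<mu>G \<rho> f = {x. integrable \<mu>G (\<lambda>g. f (\<rho> (- g) x))}"

definition zak_ext ::
    "'g::topological_ab_group_add measure \<Rightarrow> ('g \<Rightarrow> 'x \<Rightarrow> 'x) \<Rightarrow> ('x \<Rightarrow> complex) \<Rightarrow>
       'x \<times> ('g \<Rightarrow> complex) \<Rightarrow> complex" where
  "zak_ext \<mu>G \<rho> f =
     (\<lambda>(x, \<xi>) \<in> zak_dom \<mu>G \<rho> f \<times> dual_group. LINT g|\<mu>G. f (\<rho> (- g) x) * cnj (\<xi> g))"

definition zak ::
    "'g::topological_ab_group_add measure \<Rightarrow> ('g \<Rightarrow> 'x \<Rightarrow> 'x) \<Rightarrow> 'x set \<Rightarrow> ('x \<Rightarrow> complex) \<Rightarrow>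
       'x \<times> ('g \<Rightarrow> complex) \<Rightarrow> complex" where
  "zak \<mu>G \<rho> F f =
     (\<lambda>(x, \<xi>) \<in> (F \<inter> zak_dom \<mu>G \<rho> f) \<times> dual_group. LINT g|\<mu>G. f (\<rho> (- g) x) * cnj (\<xi> g))"

end

theory Submission
  imports Defs
begin

text \<open>Moving the base point from \<open>x\<close> to \<open>\<rho> (- g) x\<close> replaces
  the integration variable \<open>h\<close> by \<open>g + h\<close> in the argument of
  \<open>f\<close>. Since \<open>1 = \<xi> g * cnj (\<xi> g)\<close> and \<xi> is multiplicative,
  \<open>cnj (\<xi> h)\<close> equals \<open>\<xi> g * cnj (\<xi> (g + h))\<close>. Left invariance
  of Haar measure then removes the shift and leaves the factor \<open>\<xi> g\<close>; this is
  \<open>zak_ext_translate\<close>. If \<open>g\<close> fixes the base point, the transform equals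
  its own multiple by a value of \<xi>, so it vanishes as soon as that value is not 1; this is
  \<open>zak_ext_eq_0\<close>.\<close>

lemma continuous_on_add_left:
  fixes k :: "'g::topological_monoid_add"
  shows "continuous_on UNIV (\<lambda>g. k + g)"
  unfolding continuous_on_def by (auto intro!: tendsto_add)

lemma sets_left_haar_measure:
  "left_haar_measure M \<Longrightarrow> sets M = sets borel"
  by (simp add: left_haar_measure_def radon_measure_euclidean_sets)

lemma left_haar_measure_translation_measurable:
  assumes "left_haar_measure M"
  shows "(\<lambda>g. k + g) \<in> measurable M M"
  using borel_measurable_continuous_onI[OF continuous_on_add_left[of k]]
    sets_left_haar_measure[OF assms]
  by (simp cong: measurable_cong_sets)

text \<open>Invariance as an equality of measures lets \<open>integral_distr\<close> and
  \<open>integrable_distr\<close> carry it over to integrals. The definition speaks of images of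
  sets and a pushforward of preimages; the preimage under translation by \<open>k\<close> is the
  image under translation by \<open>- k\<close>.\<close>

lemma left_haar_measure_distr:
  assumes haar: "left_haar_measure M"
  shows "distr M M (\<lambda>g. k + g) = M"
proof (rule measure_eqI)
  fix A assume "A \<in> sets (distr M M (\<lambda>g. k + g))"
  then have A: "A \<in> sets M" by simp
  have space: "space M = UNIV"
    using sets_eq_imp_space_eq[OF sets_left_haar_measure[OF haar]] by simp
  have "(\<lambda>g. k + g) -` A = (\<lambda>g. - k + g) ` A"
  proof (intro equalityI subsetI)
    fix g assume "g \<in> (\<lambda>g. k + g) -` A"
    then show "g \<in> (\<lambda>g. - k + g) ` A"
      by (intro image_eqI[of _ _ "k + g"]) (simp_all flip: add.assoc)
  qed (auto simp flip: add.assoc)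
  then show "emeasure (distr M M (\<lambda>g. k + g)) A = emeasure M A"
    using haar A
    by (simp add: emeasure_distr left_haar_measure_translation_measurable space
        left_haar_measure_def)
qed simp

lemma left_haar_measure_integral_translation:
  fixes \<phi> :: "'g::topological_group_add \<Rightarrow> 'b::{banach, second_countable_topology}"
  assumes haar: "left_haar_measure M" and \<phi>: "\<phi> \<in> borel_measurable M"
  shows "(LINT g|M. \<phi> (k + g)) = (LINT g|M. \<phi> g)"
  using integral_distr[OF left_haar_measure_translation_measurable[OF haar] \<phi>]
  by (simp add: left_haar_measure_distr[OF haar])

lemma left_haar_measure_integrable_translation:
  fixes \<phi> :: "'g::topological_group_add \<Rightarrow> 'b::{banach, second_countable_topology}"
  assumes haar: "left_haar_measure M" and \<phi>: "integrable M \<phi>"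
  shows "integrable M (\<lambda>g. \<phi> (k + g))"
  using integrable_distr[OF left_haar_measure_translation_measurable[OF haar]] \<phi>
  by (simp add: left_haar_measure_distr[OF haar])

lemma dual_group_zero:
  assumes "\<xi> \<in> dual_group"
  shows "\<xi> 0 = 1"
proof -
  \<comment> \<open>An idempotent complex number is 0 or 1, and the norm excludes 0.\<close>
  have "norm (\<xi> 0) = 1" "\<xi> (0 + 0) = \<xi> 0 * \<xi> 0"
    using assms unfolding dual_group_def by blast+
  then show ?thesis by auto
qed

lemma dual_group_minus:
  assumes "\<xi> \<in> dual_group"
  shows "\<xi> (- g) = cnj (\<xi> g)"
proof -
  have "\<xi> g * \<xi> (- g) = \<xi> (g + - g)"
    using assms unfolding dual_group_def by (metis (mono_tags, lifting) mem_Collect_eq)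
  then have "\<xi> g * \<xi> (- g) = 1"
    by (simp add: dual_group_zero[OF assms])
  moreover have "norm (\<xi> g) = 1"
    using assms by (simp add: dual_group_def)
  then have "\<xi> g * cnj (\<xi> g) = 1" "\<xi> g \<noteq> 0"
    by (auto simp: complex_norm_square[symmetric])
  ultimately show ?thesis
    by (metis mult_left_cancel)
qed

text \<open>Inversion reverses the order of the factors, so the shift by \<open>g\<close> lands on
  the left of \<open>h\<close>, where left invariance applies.\<close>

lemma action_translate:
  assumes "continuous_action \<rho>"
  shows "\<rho> (- h) (\<rho> (- g) x) = \<rho> (- (g + h)) x"
  using assms by (simp only: continuous_action_def minus_add)

text \<open>The transforms are unspecified outside \<open>zak_dom\<close>, so the translated point
  must be shown to lie in it before its integral can be unfolded.\<close>

lemma zak_dom_invariant: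
  assumes "left_haar_measure \<mu>G" "continuous_action \<rho>" "x \<in> zak_dom \<mu>G \<rho> f"
  shows "\<rho> (- g) x \<in> zak_dom \<mu>G \<rho> f"
  using left_haar_measure_integrable_translation[OF assms(1), of "\<lambda>h. f (\<rho> (- h) x)" g] assms(3)
  by (simp only: zak_dom_def mem_Collect_eq action_translate[OF assms(2)])

lemma zak_ext_translate:
  assumes haar: "left_haar_measure \<mu>G" and act: "continuous_action \<rho>"
    and x: "x \<in> zak_dom \<mu>G \<rho> f" and \<xi>: "\<xi> \<in> dual_group"
  shows "zak_ext \<mu>G \<rho> f (\<rho> (- g) x, \<xi>) = \<xi> g * zak_ext \<mu>G \<rho> f (x, \<xi>)"
proof -
  define \<phi> where "\<phi> h = f (\<rho> (- h) x) * cnj (\<xi> h)" for h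
  have add: "\<xi> (a + b) = \<xi> a * \<xi> b" for a b
    using \<xi> by (simp add: dual_group_def)
  have "continuous_on UNIV (\<lambda>h. cnj (\<xi> h))"
    using \<xi> by (auto simp: dual_group_def intro: continuous_on_cnj)
  then have "(\<lambda>h. cnj (\<xi> h)) \<in> borel_measurable \<mu>G"
    using borel_measurable_continuous_onI sets_left_haar_measure[OF haar]
    by (simp cong: measurable_cong_sets)
  then have \<phi>: "\<phi> \<in> borel_measurable \<mu>G"
    using x unfolding \<phi>_def zak_dom_def
    by (intro borel_measurable_times) (auto intro: borel_measurable_integrable)
  have unit: "\<xi> g * cnj (\<xi> g) = 1"
    using \<xi> by (simp add: dual_group_def complex_norm_square[symmetric])
  have "f (\<rho> (- h) (\<rho> (- g) x)) * cnj (\<xi> h) = \<xi> g * \<phi> (g + h)" for h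
  proof -
    \<comment> \<open>The bracketed factor is 1 by \<open>unit\<close>, which cancels the
      \<open>cnj (\<xi> g)\<close> split off from \<open>cnj (\<xi> (g + h))\<close>.\<close>
    have "\<xi> g * \<phi> (g + h) = (\<xi> g * cnj (\<xi> g)) * (f (\<rho> (- (g + h)) x) * cnj (\<xi> h))"
      unfolding \<phi>_def add complex_cnj_mult by (simp only: ac_simps)
    then show ?thesis
      by (simp only: unit action_translate[OF act] mult_1_left)
  qed
  then have "zak_ext \<mu>G \<rho> f (\<rho> (- g) x, \<xi>) = \<xi> g * (LINT h|\<mu>G. \<phi> (g + h))"
    using zak_dom_invariant[OF haar act x] \<xi> by (simp add: zak_ext_def)
  also have "\<dots> = \<xi> g * (LINT h|\<mu>G. \<phi> h)"
    by (simp only: left_haar_measure_integral_translation[OF haar \<phi>])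
  finally show ?thesis
    using x \<xi> by (simp add: zak_ext_def \<phi>_def)
qed

text \<open>Over \<open>F\<close> the two restrictions have the same domain; outside it both sides
  are the same unspecified value, so only \<open>x \<in> F\<close> is assumed.\<close>

lemma zak_ext_eq_zak:
  assumes "x \<in> F"
  shows "zak_ext \<mu>G \<rho> f (x, \<xi>) = zak \<mu>G \<rho> F f (x, \<xi>)"
  using assms by (simp add: zak_ext_def zak_def restrict_def)

lemma zak_ext_eq_0:
  assumes haar: "left_haar_measure \<mu>G" and act: "continuous_action \<rho>"
    and x: "x \<in> zak_dom \<mu>G \<rho> f" and \<xi>: "\<xi> \<in> dual_group"
    and "\<xi> \<notin> annihilator (stabilizer \<rho> x)"
  shows "zak_ext \<mu>G \<rho> f (x, \<xi>) = 0"
proof -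
  obtain h where h: "\<rho> h x = x" "\<xi> h \<noteq> 1"
    using assms by (auto simp: annihilator_def stabilizer_def)
  \<comment> \<open>Translating by \<open>- h\<close> moves \<open>x\<close> to
    \<open>\<rho> h x\<close>, which is \<open>x\<close> itself.\<close>
  have "zak_ext \<mu>G \<rho> f (x, \<xi>) = \<xi> (- h) * zak_ext \<mu>G \<rho> f (x, \<xi>)"
    using zak_ext_translate[OF haar act x \<xi>, of "- h"] h by simp
  moreover have "\<xi> (- h) \<noteq> 1"
    using h(2) by (simp add: dual_group_minus[OF \<xi>])
  ultimately show ?thesis by simp
qed

theorem lemma3p2:
  fixes \<rho> :: "'g::{topological_ab_group_add, t2_space} \<Rightarrow> 'x::t2_space \<Rightarrow> 'x"
    and \<mu>G :: "'g measure" and \<mu>s :: "'x measure"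
    and F :: "'x set" and f :: "'x \<Rightarrow> complex"
  assumes "locally_compact_space (euclidean :: 'g topology)"
    and "locally_compact_space (euclidean :: 'x topology)"
    and "left_haar_measure \<mu>G"
    and "continuous_action \<rho>"
    and "weil_space \<mu>G \<rho> \<mu>s"
    and "fundamental_domain \<rho> F"
    and "integrable \<mu>s f"
  shows "(\<forall>g. \<forall>x\<^sub>0 \<in> F \<inter> zak_dom \<mu>G \<rho> f. \<forall>\<xi> \<in> dual_group.
            zak_ext \<mu>G \<rho> f (\<rho> (- g) x\<^sub>0, \<xi>) = \<xi> g * zak \<mu>G \<rho> F f (x\<^sub>0, \<xi>)) \<and>
         (\<forall>x\<^sub>0 \<in> F \<inter> zak_dom \<mu>G \<rho> f. \<forall>\<xi> \<in> dual_group.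
            \<xi> \<notin> annihilator (stabilizer \<rho> x\<^sub>0) \<longrightarrow> zak \<mu>G \<rho> F f (x\<^sub>0, \<xi>) = 0)"
  using assms(3,4)
  by (auto simp: zak_ext_translate zak_ext_eq_0 simp flip: zak_ext_eq_zak)

end
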